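(* Let $\mathbb{F}$ be any field, $S\subseteq\mathbb{F}$ a finite set, and $k \in \mathbb{N}$. The asymptotic rank $\lim_{m\to\infty} R(T^{\boxtimes m})^{1/m}$ on $k$-tensors $T$ over $S$ has no accumulation points. In particular, the asymptotic rank on $k$-tensors over a finite field has no accumulation points.
   Context: A $k$-tensor over $S$ is an element of $\mathbb{F}^{n_1}\otimes\cdots\otimes\mathbb{F}^{n_k}$ (any $n_1,\dots,n_k$) with all coefficients in $S$. The tensor rank $R(T)$ is the smallest number of tensors of the form $v_1\otimes\cdots\otimes v_k$ summing to $T$; $\boxtimes$ is the Kronecker product. "No accumulation points" refers to the set of values over all such tensors of all formats. *)

theory Defs
  imports "HOL-Analysis.Elementary_Topology" "HOL-Library.FuncSet"
begin

definition multi_indices :: "nat list \<Rightarrow> nat list set" where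
  "multi_indices ns = {I. length I = length ns \<and> (\<forall>j<length ns. I ! j < ns ! j)}"

text \<open>
  A tensor is its format \<open>[n\<^sub>1, \<dots>, n\<^sub>k]\<close> together with its coefficients in the standard basis.
  Coefficient functions are kept in \<open>extensional (multi_indices ns)\<close>, so that equality
  of pairs is equality of tensors. Coordinates are counted from 0.
\<close>

type_synonym 'a tensor = "nat list \<times> (nat list \<Rightarrow> 'a)"

definition tensors_over :: "nat \<Rightarrow> 'a set \<Rightarrow> 'a tensor set" where
  "tensors_over k S = {(ns, T). length ns = k \<and> T \<in> multi_indices ns \<rightarrow>\<^sub>E S}"

text \<open>A vector in \<open>F\<^sup>n\<close> is a list of length \<open>n\<close>.\<close>

definition pure_tensor :: "'a::field list list \<Rightarrow> 'a tensor" where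
  "pure_tensor vs =
    (map length vs, \<lambda>I\<in>multi_indices (map length vs). \<Prod>j<length vs. vs ! j ! (I ! j))"

definition tensor_sum :: "nat list \<Rightarrow> 'a::field tensor list \<Rightarrow> 'a tensor" where
  "tensor_sum ns Ts = (ns, \<lambda>I\<in>multi_indices ns. \<Sum>T\<leftarrow>Ts. snd T I)"

definition tensor_rank :: "'a::field tensor \<Rightarrow> nat" where
  "tensor_rank T = (LEAST r. \<exists>Ts. length Ts = r
     \<and> (\<forall>P\<in>set Ts. \<exists>vs. map length vs = fst T \<and> P = pure_tensor vs)
     \<and> T = tensor_sum (fst T) Ts)"

text \<open>
  The tensor factors are combined positionwise, and the basis of \<open>F\<^sup>n \<otimes> F\<^sup>m\<close> is numbered
  lexicographically: the pair \<open>(a, b)\<close> becomes \<open>a * m + b\<close>. Both tensors must have the same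
  order.
\<close>

definition kronecker :: "'a::field tensor \<Rightarrow> 'a tensor \<Rightarrow> 'a tensor" where
  "kronecker A B =
    (let ns = map2 (*) (fst A) (fst B)
     in (ns, \<lambda>I\<in>multi_indices ns.
               snd A (map2 (div) I (fst B)) * snd B (map2 (mod) I (fst B))))"

primrec kronecker_power :: "'a::field tensor \<Rightarrow> nat \<Rightarrow> 'a tensor" where
  "kronecker_power T 0 = pure_tensor (replicate (length (fst T)) [1])"
| "kronecker_power T (Suc m) = kronecker (kronecker_power T m) T"

text \<open>
  The limit exists for every tensor of order at least 1, since the rank is submultiplicative
  under \<^const>\<open>kronecker\<close> (Fekete's lemma).
\<close>

definition asymptotic_rank :: "'a::field tensor \<Rightarrow> real" where
  "asymptotic_rank T = lim (\<lambda>m. root m (real (tensor_rank (kronecker_power T m))))"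

end

theory Submission
  imports Defs
begin

text \<open>
  If the slices of \<open>T\<close> in one direction are linearly dependent, then some slice is a linear
  combination of the others, and deleting it changes neither the rank of any Kronecker power
  nor the fact that the coefficients lie in \<open>S\<close>. So every value of the asymptotic rank is taken
  by a tensor over \<open>S\<close> with linearly independent slices in all directions. Independence of the
  slices passes to Kronecker powers and bounds the rank from below, so such a tensor of format
  \<open>(n\<^sub>1, \<dots>, n\<^sub>k)\<close> has asymptotic rank at least \<open>max n\<^sub>i\<close>. Hence only finitely many values lie
  below any given bound.
\<close>

section \<open>Lexicographic double sums, homogeneous linear systems, multi-indices\<close>

lemma sum_lessThan_mult:
  fixes f :: "nat \<Rightarrow> 'b::comm_monoid_add"
  shows "(\<Sum>c<n * m. f c) = (\<Sum>a<n. \<Sum>b<m. f (a * m + b))"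
proof -
  have "(\<Sum>c<n * m. f c) = (\<Sum>a<n. sum f {a * m..<a * m + m})"
    using sum.nat_group[of f m n] by (simp add: mult.commute)
  also have "\<dots> = (\<Sum>a<n. \<Sum>b<m. f (a * m + b))"
    using sum.shift_bounds_nat_ivl[of f 0 "_ * m" m]
    by (simp add: add.commute atLeast0LessThan)
  finally show ?thesis .
qed

lemma mult_add_less:
  fixes a b n m :: nat
  assumes "a < n" "b < m"
  shows "a * m + b < n * m"
proof -
  have "a * m + b < Suc a * m" using assms by simp
  also have "\<dots> \<le> n * m" using assms by (intro mult_right_mono) auto
  finally show ?thesis .
qed

text \<open>Gaussian elimination, by induction on the number of equations: a nonzero entry of
  equation \<open>r\<close> serves as pivot, and its unknown is eliminated from the other
  equations.\<close>

lemma homogeneous_system_nontrivial_solution: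
  fixes f :: "nat \<Rightarrow> 'b \<Rightarrow> 'a::field"
  assumes "finite A" "r < card A"
  shows "\<exists>c. (\<exists>a\<in>A. c a \<noteq> 0) \<and> (\<forall>s<r. (\<Sum>a\<in>A. c a * f s a) = 0)"
  using assms
proof (induction r arbitrary: A f)
  case 0
  then have "A \<noteq> {}" by auto
  then show ?case by (intro exI[of _ "\<lambda>_. 1"]) auto
next
  case (Suc r)
  show ?case
  proof (cases "\<forall>a\<in>A. f r a = 0")
    case True
    then show ?thesis
      using Suc.IH[OF Suc.prems(1), of f] Suc.prems(2) by (auto simp: less_Suc_eq)
  next
    case False
    then obtain p where p: "p \<in> A" "f r p \<noteq> 0" by blast
    define B where "B = A - {p}"
    have B: "finite B" "r < card B" "p \<notin> B" "A = insert p B"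
      using Suc.prems p by (auto simp: B_def)
    \<comment> \<open>These coefficients arise by solving equation \<open>r\<close> for the unknown
      \<open>p\<close> and substituting the result into equation \<open>s\<close>.\<close>
    obtain c where c: "\<exists>a\<in>B. c a \<noteq> 0"
      "\<And>s. s < r \<Longrightarrow> (\<Sum>a\<in>B. c a * (f s a - f s p * f r a / f r p)) = 0"
      using Suc.IH[OF B(1,2), of "\<lambda>s a. f s a - f s p * f r a / f r p"] by auto
    \<comment> \<open>The value of the unknown \<open>p\<close> that equation \<open>r\<close>
      forces.\<close>
    define x where "x = - (\<Sum>a\<in>B. c a * f r a) / f r p"
    have upd: "(\<Sum>a\<in>A. (c(p := x)) a * f s a) = x * f s p + (\<Sum>a\<in>B. c a * f s a)" for s
    proof -
      have "(\<Sum>a\<in>B. (c(p := x)) a * f s a) = (\<Sum>a\<in>B. c a * f s a)"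
        using B(3) by (intro sum.cong) auto
      then show ?thesis using B by simp
    qed
    have "(\<Sum>a\<in>A. (c(p := x)) a * f s a) = 0" if "s < Suc r" for s
    proof (cases "s = r")
      case True
      then show ?thesis using p unfolding upd by (simp add: x_def)
    next
      case False
      have "0 = (\<Sum>a\<in>B. c a * (f s a - f s p * f r a / f r p))"
        using c(2) that False by simp
      also have "\<dots> = (\<Sum>a\<in>B. c a * f s a) - (\<Sum>a\<in>B. f s p / f r p * (c a * f r a))"
        by (simp add: sum_subtractf[symmetric] algebra_simps)
      also have "\<dots> = (\<Sum>a\<in>B. c a * f s a) - f s p / f r p * (\<Sum>a\<in>B. c a * f r a)"
        by (simp add: sum_distrib_left)
      finally show ?thesis unfolding upd unfolding x_def by (simp add: algebra_simps)
    qed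
    moreover have "\<exists>a\<in>A. (c(p := x)) a \<noteq> 0" using c(1) B(3,4) by auto
    ultimately show ?thesis by blast
  qed
qed

lemma finite_multi_indices: "finite (multi_indices ns)"
proof -
  have "multi_indices ns \<subseteq> {I. set I \<subseteq> {..sum_list ns} \<and> length I = length ns}"
    unfolding multi_indices_def
    by (auto simp: in_set_conv_nth) (meson elem_le_sum_list le_trans less_imp_le)
  then show ?thesis using finite_lists_length_eq[of "{..sum_list ns}"] finite_subset by blast
qed

lemma multi_indices_update:
  assumes "I \<in> multi_indices ns" "length ms = length ns" "b < ms ! i"
    and "\<And>j. j < length ns \<Longrightarrow> j \<noteq> i \<Longrightarrow> ms ! j = ns ! j"
  shows "I[i := b] \<in> multi_indices ms"
proof -
  have "I[i := b] ! j < ms ! j" if "j < length ns" for j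
    using assms that by (cases "j = i") (auto simp: multi_indices_def)
  then show ?thesis using assms by (simp add: multi_indices_def)
qed

subsection \<open>Rank decompositions\<close>

text \<open>\<open>u s j a\<close> is coordinate \<open>a\<close> of the \<open>j\<close>-th vector
  in the \<open>s\<close>-th pure tensor. Vectors are functions on all of \<open>nat\<close>, and
  only values on the format are compared, so no list lengths have to be tracked.\<close>

definition rank_decomp :: "'a::field tensor \<Rightarrow> nat \<Rightarrow> (nat \<Rightarrow> nat \<Rightarrow> nat \<Rightarrow> 'a) \<Rightarrow> bool" where
  "rank_decomp T r u \<longleftrightarrow>
    (\<forall>I\<in>multi_indices (fst T). snd T I = (\<Sum>s<r. \<Prod>j<length (fst T). u s j (I ! j)))"

text \<open>Extensionality turns agreement on the multi-indices, which is all that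
  \<open>rank_decomp\<close> asserts, into the equality of tensors used by
  \<open>tensor_rank\<close>.\<close>

lemma tensor_rank_eq:
  assumes "snd T \<in> extensional (multi_indices (fst T))"
  shows "tensor_rank T = (LEAST r. \<exists>u. rank_decomp T r u)"
proof -
  obtain ns t where T: "T = (ns, t)" by fastforce
  have t: "t \<in> extensional (multi_indices ns)" using assms T by simp
  have "(\<exists>Ts. length Ts = r
     \<and> (\<forall>P\<in>set Ts. \<exists>vs. map length vs = fst T \<and> P = pure_tensor vs)
     \<and> T = tensor_sum (fst T) Ts) \<longleftrightarrow> (\<exists>u. rank_decomp T r u)" for r
  proof
    assume "\<exists>Ts. length Ts = r
     \<and> (\<forall>P\<in>set Ts. \<exists>vs. map length vs = fst T \<and> P = pure_tensor vs)
     \<and> T = tensor_sum (fst T) Ts"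
    then obtain Ts where Ts: "length Ts = r"
      "\<forall>P\<in>set Ts. \<exists>vs. map length vs = ns \<and> P = pure_tensor vs"
      "T = tensor_sum ns Ts" using T by auto
    then have "\<forall>s. \<exists>vs. s < r \<longrightarrow> map length vs = ns \<and> Ts ! s = pure_tensor vs" by auto
    then obtain vs where vs: "\<And>s. s < r \<Longrightarrow> map length (vs s) = ns \<and> Ts ! s = pure_tensor (vs s)"
      by metis
    have "rank_decomp T r (\<lambda>s j a. vs s ! j ! a)"
      unfolding rank_decomp_def
    proof
      fix I assume "I \<in> multi_indices (fst T)"
      then have I: "I \<in> multi_indices ns" using T by simp
      have "snd T I = (\<Sum>s<r. snd (Ts ! s) I)"
        using I Ts(1,3) by (simp add: tensor_sum_def sum_list_sum_nth atLeast0LessThan)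
      also have "\<dots> = (\<Sum>s<r. \<Prod>j<length (fst T). vs s ! j ! (I ! j))"
      proof (intro sum.cong refl)
        fix s assume "s \<in> {..<r}"
        then have v: "map length (vs s) = ns" "Ts ! s = pure_tensor (vs s)" using vs by auto
        have "length (vs s) = length ns" using v(1) by (metis length_map)
        then show "snd (Ts ! s) I = (\<Prod>j<length (fst T). vs s ! j ! (I ! j))"
          using v I T by (simp add: pure_tensor_def)
      qed
      finally show "snd T I = (\<Sum>s<r. \<Prod>j<length (fst T). vs s ! j ! (I ! j))" .
    qed
    then show "\<exists>u. rank_decomp T r u" by blast
  next
    assume "\<exists>u. rank_decomp T r u"
    then obtain u where u: "\<And>I. I \<in> multi_indices ns \<Longrightarrow>
        t I = (\<Sum>s<r. \<Prod>j<length ns. u s j (I ! j))"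
      unfolding rank_decomp_def T by auto
    \<comment> \<open>The functions \<open>u s j\<close> are truncated to lists of the lengths
      prescribed by the format.\<close>
    define vs where "vs s = map (\<lambda>j. map (u s j) [0..<ns ! j]) [0..<length ns]" for s
    have len: "map length (vs s) = ns" "length (vs s) = length ns" for s
      by (auto simp: vs_def intro: nth_equalityI)
    define Ts where "Ts = map (\<lambda>s. pure_tensor (vs s)) [0..<r]"
    have "snd (pure_tensor (vs s)) I = (\<Prod>j<length ns. u s j (I ! j))"
      if "I \<in> multi_indices ns" for s I
      using that by (auto simp: pure_tensor_def len vs_def multi_indices_def intro!: prod.cong)
    then have "t I = (\<Sum>P\<leftarrow>Ts. snd P I)" if "I \<in> multi_indices ns" for I
      using u[OF that] that
      by (simp add: Ts_def sum_list_sum_nth atLeast0LessThan)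
    then have "t = (\<lambda>I\<in>multi_indices ns. \<Sum>P\<leftarrow>Ts. snd P I)"
      using t by (intro extensionalityI[OF t]) auto
    then have "T = tensor_sum (fst T) Ts" by (simp add: T tensor_sum_def)
    moreover have "\<forall>P\<in>set Ts. \<exists>vs. map length vs = fst T \<and> P = pure_tensor vs"
      using len T by (auto simp: Ts_def)
    moreover have "length Ts = r" by (simp add: Ts_def)
    ultimately show "\<exists>Ts. length Ts = r
     \<and> (\<forall>P\<in>set Ts. \<exists>vs. map length vs = fst T \<and> P = pure_tensor vs)
     \<and> T = tensor_sum (fst T) Ts" by blast
  qed
  then show ?thesis by (simp add: tensor_rank_def)
qed

text \<open>In order 0 the coefficients could not be absorbed into a factor: a scalar that is not a
  natural multiple of 1 has no decomposition at all.\<close>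

lemma rank_decomp_exists:
  assumes "fst T \<noteq> []"
  shows "\<exists>r u. rank_decomp T r u"
proof -
  let ?A = "multi_indices (fst T)" and ?k = "length (fst T)"
  obtain h where h: "bij_betw h {..<card ?A} ?A"
    using ex_bij_betw_nat_finite[OF finite_multi_indices] by (auto simp: atLeast0LessThan)
  \<comment> \<open>Expansion in the standard basis: the term \<open>s\<close> is the basis tensor
    at position \<open>h s\<close>, and its coefficient is put into factor 0.\<close>
  define u where "u s j a = (if j = 0 then snd T (h s) else 1) * (if a = h s ! j then 1 else 0)"
    for s j a
  have "rank_decomp T (card ?A) u"
    unfolding rank_decomp_def
  proof
    fix I assume I: "I \<in> ?A"
    have prod: "(\<Prod>j<?k. u s j (I ! j)) = (if h s = I then snd T I else 0)"
      if "s < card ?A" for s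
    proof -
      have hs: "h s \<in> ?A" using h that by (auto simp: bij_betw_def)
      have "(\<Prod>j<?k. if j = 0 then snd T (h s) else 1) = snd T (h s)"
        using assms by (simp add: prod.delta)
      moreover have "(\<Prod>j<?k. if I ! j = h s ! j then 1 else 0) = (if h s = I then 1 else (0::'a))"
      proof (cases "h s = I")
        case False
        have "length (h s) = ?k" "length I = ?k" using I hs by (auto simp: multi_indices_def)
        then obtain j where "j < ?k" "I ! j \<noteq> h s ! j" using False by (metis nth_equalityI)
        then have "(\<Prod>j<?k. if I ! j = h s ! j then 1 else 0) = (0::'a)"
          by (intro prod_zero) auto
        then show ?thesis using False by simp
      qed auto
      ultimately show ?thesis by (simp add: u_def prod.distrib)
    qed
    have "(\<Sum>s<card ?A. \<Prod>j<?k. u s j (I ! j)) = (\<Sum>s<card ?A. if h s = I then snd T I else 0)"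
      using prod by (intro sum.cong) auto
    also have "\<dots> = (\<Sum>J\<in>?A. if J = I then snd T I else 0)"
      by (rule sum.reindex_bij_betw[OF h])
    also have "\<dots> = snd T I" using I finite_multi_indices by (simp add: sum.delta)
    finally show "snd T I = (\<Sum>s<card ?A. \<Prod>j<?k. u s j (I ! j))" by simp
  qed
  then show ?thesis by blast
qed

text \<open>Splits off factor \<open>i\<close>, so that the dependence on coordinate
  \<open>i\<close> sits in a single vector; the remaining product is the same for all
  slices.\<close>

lemma prod_nth_list_update:
  fixes u :: "nat \<Rightarrow> nat \<Rightarrow> 'a::field"
  assumes "i < k" "length I = k"
  shows "(\<Prod>j<k. u j (I[i := b] ! j)) = u i b * (\<Prod>j\<in>{..<k} - {i}. u j (I ! j))"
proof -
  have "(\<Prod>j<k. u j (I[i := b] ! j))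
      = u i (I[i := b] ! i) * (\<Prod>j\<in>{..<k} - {i}. u j (I[i := b] ! j))"
    using assms by (intro prod.remove) auto
  also have "(\<Prod>j\<in>{..<k} - {i}. u j (I[i := b] ! j)) = (\<Prod>j\<in>{..<k} - {i}. u j (I ! j))"
    by (intro prod.cong) auto
  finally show ?thesis using assms by simp
qed

subsection \<open>Kronecker products\<close>

lemma fst_kronecker: "fst (kronecker A B) = map2 (*) (fst A) (fst B)"
  by (simp add: kronecker_def Let_def)

lemma snd_kronecker:
  "I \<in> multi_indices (fst (kronecker A B)) \<Longrightarrow>
    snd (kronecker A B) I = snd A (map2 (div) I (fst B)) * snd B (map2 (mod) I (fst B))"
  by (simp add: kronecker_def Let_def)

lemma multi_indices_div_mod:
  assumes "I \<in> multi_indices (map2 (*) ns ms)" "length ns = length ms"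
  shows "map2 (div) I ms \<in> multi_indices ns" "map2 (mod) I ms \<in> multi_indices ms"
proof -
  have "I ! j div ms ! j < ns ! j \<and> I ! j mod ms ! j < ms ! j" if "j < length ms" for j
  proof -
    \<comment> \<open>The strict bound also excludes \<open>ms ! j = 0\<close>, where
      \<open>mod\<close> would return its argument.\<close>
    have "I ! j < ns ! j * ms ! j" using assms that by (auto simp: multi_indices_def)
    then show ?thesis
      by (metis less_mult_imp_div_less mod_less_divisor mult_0_right not_less_zero neq0_conv)
  qed
  then show "map2 (div) I ms \<in> multi_indices ns" "map2 (mod) I ms \<in> multi_indices ms"
    using assms by (auto simp: multi_indices_def)
qed

text \<open>Two formats occur because \<open>I\<close> is an index of a product with second format
  \<open>ns\<close>, while the updated index belongs to a product with second format
  \<open>ms\<close>. They may differ only in direction \<open>i\<close>, where the entry is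
  overwritten.\<close>

lemma map2_div_mod_update:
  fixes I ms ns :: "nat list"
  assumes "length I = length ms" "length ns = length ms" "i < length ms" "b < ms ! i"
    and "\<And>j. j < length ms \<Longrightarrow> j \<noteq> i \<Longrightarrow> ns ! j = ms ! j"
  shows "map2 (div) (I[i := a * ms ! i + b]) ms = (map2 (div) I ns)[i := a]"
    and "map2 (mod) (I[i := a * ms ! i + b]) ms = (map2 (mod) I ns)[i := b]"
proof -
  have "(a * ms ! i + b) div ms ! i = a" "(a * ms ! i + b) mod ms ! i = b"
    using assms(4) by simp_all
  then show "map2 (div) (I[i := a * ms ! i + b]) ms = (map2 (div) I ns)[i := a]"
    and "map2 (mod) (I[i := a * ms ! i + b]) ms = (map2 (mod) I ns)[i := b]"
    using assms by (auto intro!: nth_equalityI simp: nth_list_update)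
qed

lemma extensional_kronecker:
  "snd (kronecker A B) \<in> extensional (multi_indices (fst (kronecker A B)))"
  by (simp add: kronecker_def Let_def)

lemma length_kronecker_power: "length (fst (kronecker_power T m)) = length (fst T)"
  by (induction m) (simp_all add: fst_kronecker pure_tensor_def)

lemma extensional_kronecker_power:
  "snd (kronecker_power T m) \<in> extensional (multi_indices (fst (kronecker_power T m)))"
  by (cases m) (simp_all add: extensional_kronecker pure_tensor_def)

lemma nth_fst_kronecker_power:
  "i < length (fst T) \<Longrightarrow> fst (kronecker_power T m) ! i = (fst T ! i) ^ m"
  by (induction m) (simp_all add: fst_kronecker length_kronecker_power pure_tensor_def)

subsection \<open>Restriction in one direction\<close>

text \<open>\<open>A\<close> is the image of \<open>B\<close> under a matrix \<open>M\<close> acting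
  on the \<open>i\<close>-th tensor factor and the identity on all others.\<close>

definition mode_restricts :: "nat \<Rightarrow> 'a::field tensor \<Rightarrow> 'a tensor \<Rightarrow> bool" where
  "mode_restricts i A B \<longleftrightarrow>
    length (fst A) = length (fst B) \<and> i < length (fst B) \<and>
    (\<forall>j<length (fst B). j \<noteq> i \<longrightarrow> fst A ! j = fst B ! j) \<and>
    (\<exists>M. \<forall>I\<in>multi_indices (fst A). snd A I = (\<Sum>b<fst B ! i. M (I ! i) b * snd B (I[i := b])))"

lemma mode_restrictsI:
  assumes "length (fst A) = length (fst B)" "i < length (fst B)"
    and "\<And>j. j < length (fst B) \<Longrightarrow> j \<noteq> i \<Longrightarrow> fst A ! j = fst B ! j"
    and "\<And>I. I \<in> multi_indices (fst A) \<Longrightarrow>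
      snd A I = (\<Sum>b<fst B ! i. M (I ! i) b * snd B (I[i := b]))"
  shows "mode_restricts i A B"
  using assms unfolding mode_restricts_def by blast

text \<open>A matrix acting on one factor sends pure tensors to pure tensors, so a decomposition of
  \<open>B\<close> is carried to one of \<open>A\<close> with equally many terms.\<close>

lemma mode_restricts_rank_decomp:
  assumes "mode_restricts i A B" "rank_decomp B r u"
  shows "\<exists>v. rank_decomp A r v"
proof -
  let ?k = "length (fst B)"
  obtain M where len: "length (fst A) = ?k" "i < ?k"
    and eq: "\<And>j. j < ?k \<Longrightarrow> j \<noteq> i \<Longrightarrow> fst A ! j = fst B ! j"
    and M: "\<And>I. I \<in> multi_indices (fst A) \<Longrightarrow>
      snd A I = (\<Sum>b<fst B ! i. M (I ! i) b * snd B (I[i := b]))"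
    using assms(1) unfolding mode_restricts_def by blast
  define v where "v s j x = (if j = i then \<Sum>b<fst B ! i. M x b * u s i b else u s j x)" for s j x
  have "rank_decomp A r v"
    unfolding rank_decomp_def
  proof
    fix I assume I: "I \<in> multi_indices (fst A)"
    have lI: "length I = ?k" using I len by (simp add: multi_indices_def)
    let ?P = "\<lambda>s. \<Prod>j\<in>{..<?k} - {i}. u s j (I ! j)"
    have "snd B (I[i := b]) = (\<Sum>s<r. u s i b * ?P s)" if "b < fst B ! i" for b
    proof -
      have "I[i := b] \<in> multi_indices (fst B)"
        using len eq that by (intro multi_indices_update[OF I]) auto
      then have "snd B (I[i := b]) = (\<Sum>s<r. \<Prod>j<?k. u s j (I[i := b] ! j))"
        using assms(2) unfolding rank_decomp_def by blast
      then show ?thesis by (simp only: prod_nth_list_update[OF len(2) lI])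
    qed
    then have "snd A I = (\<Sum>b<fst B ! i. \<Sum>s<r. M (I ! i) b * (u s i b * ?P s))"
      using M[OF I] by (simp add: sum_distrib_left)
    also have "\<dots> = (\<Sum>s<r. \<Sum>b<fst B ! i. M (I ! i) b * (u s i b * ?P s))"
      by (rule sum.swap)
    also have "\<dots> = (\<Sum>s<r. \<Prod>j<?k. v s j (I ! j))"
    proof (intro sum.cong refl)
      fix s
      have "(\<Prod>j<?k. v s j (I ! j)) = v s i (I ! i) * (\<Prod>j\<in>{..<?k} - {i}. v s j (I ! j))"
        using prod_nth_list_update[OF len(2) lI, of "v s" "I ! i"] by simp
      also have "(\<Prod>j\<in>{..<?k} - {i}. v s j (I ! j)) = ?P s"
        by (intro prod.cong) (auto simp: v_def)
      finally show "(\<Sum>b<fst B ! i. M (I ! i) b * (u s i b * ?P s)) = (\<Prod>j<?k. v s j (I ! j))"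
        by (simp add: v_def sum_distrib_right mult.assoc)
    qed
    finally show "snd A I = (\<Sum>s<r. \<Prod>j<length (fst A). v s j (I ! j))" using len by simp
  qed
  then show ?thesis by blast
qed

lemma mode_restricts_kronecker:
  assumes "mode_restricts i A B" "mode_restricts i A' B'" "length (fst B) = length (fst B')"
  shows "mode_restricts i (kronecker A A') (kronecker B B')"
proof -
  let ?k = "length (fst B)" and ?n = "fst B ! i" and ?n' = "fst B' ! i"
  obtain M where len: "length (fst A) = ?k" "i < ?k"
    and eq: "\<And>j. j < ?k \<Longrightarrow> j \<noteq> i \<Longrightarrow> fst A ! j = fst B ! j"
    and M: "\<And>I. I \<in> multi_indices (fst A) \<Longrightarrow>
      snd A I = (\<Sum>b<?n. M (I ! i) b * snd B (I[i := b]))"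
    using assms(1) unfolding mode_restricts_def by blast
  obtain M' where len': "length (fst A') = ?k"
    and eq': "\<And>j. j < ?k \<Longrightarrow> j \<noteq> i \<Longrightarrow> fst A' ! j = fst B' ! j"
    and M': "\<And>I. I \<in> multi_indices (fst A') \<Longrightarrow>
      snd A' I = (\<Sum>b<?n'. M' (I ! i) b * snd B' (I[i := b]))"
    using assms(2) unfolding mode_restricts_def assms(3)[symmetric] by blast
  \<comment> \<open>The Kronecker product of the matrices \<open>M\<close> and \<open>M'\<close> in
    the lexicographic numbering: rows are split by the format of \<open>A'\<close>, columns by that
    of \<open>B'\<close>.\<close>
  define N where "N x c = M (x div fst A' ! i) (c div ?n') * M' (x mod fst A' ! i) (c mod ?n')"
    for x c
  have nth: "fst (kronecker B B') ! i = ?n * ?n'" using len assms(3) by (simp add: fst_kronecker)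
  have eqK: "\<And>j. j < ?k \<Longrightarrow> j \<noteq> i \<Longrightarrow> fst (kronecker A A') ! j = fst (kronecker B B') ! j"
    using len len' eq eq' assms(3) by (simp add: fst_kronecker)
  have "snd (kronecker A A') I
      = (\<Sum>c<fst (kronecker B B') ! i. N (I ! i) c * snd (kronecker B B') (I[i := c]))"
    if I: "I \<in> multi_indices (fst (kronecker A A'))" for I
  proof -
    let ?J = "map2 (div) I (fst A')" and ?K = "map2 (mod) I (fst A')"
    have lI: "length I = ?k" using I len len' by (simp add: multi_indices_def fst_kronecker)
    have JK: "?J \<in> multi_indices (fst A)" "?K \<in> multi_indices (fst A')"
      using multi_indices_div_mod[of I "fst A" "fst A'"] I len len' by (simp_all add: fst_kronecker)
    have i: "?J ! i = I ! i div fst A' ! i" "?K ! i = I ! i mod fst A' ! i"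
      using lI len len' by auto
    have summand: "N (I ! i) (a * ?n' + b) * snd (kronecker B B') (I[i := a * ?n' + b])
        = (M (?J ! i) a * snd B (?J[i := a])) * (M' (?K ! i) b * snd B' (?K[i := b]))"
      if ab: "a < ?n" "b < ?n'" for a b
    proof -
      have "I[i := a * ?n' + b] \<in> multi_indices (fst (kronecker B B'))"
      proof (rule multi_indices_update[OF I])
        show "a * ?n' + b < fst (kronecker B B') ! i" using mult_add_less[OF ab] nth by simp
      qed (use len len' assms(3) eqK in \<open>auto simp: fst_kronecker\<close>)
      moreover have "map2 (div) (I[i := a * ?n' + b]) (fst B') = ?J[i := a]"
        "map2 (mod) (I[i := a * ?n' + b]) (fst B') = ?K[i := b]"
        using map2_div_mod_update[of I "fst B'" "fst A'" i b a] lI len len' assms(3) ab eq'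
        by simp_all
      ultimately show ?thesis using ab by (simp add: snd_kronecker N_def i mult_ac)
    qed
    have "snd (kronecker A A') I = snd A ?J * snd A' ?K" using I by (rule snd_kronecker)
    also have "\<dots> = (\<Sum>a<?n. \<Sum>b<?n'.
        (M (?J ! i) a * snd B (?J[i := a])) * (M' (?K ! i) b * snd B' (?K[i := b])))"
      unfolding M[OF JK(1)] M'[OF JK(2)] by (rule sum_product)
    also have "\<dots> = (\<Sum>a<?n. \<Sum>b<?n'.
        N (I ! i) (a * ?n' + b) * snd (kronecker B B') (I[i := a * ?n' + b]))"
      using summand by (intro sum.cong refl) simp
    also have "\<dots> = (\<Sum>c<?n * ?n'. N (I ! i) c * snd (kronecker B B') (I[i := c]))"
      by (rule sum_lessThan_mult[symmetric])
    finally show ?thesis by (simp add: nth)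
  qed
  moreover have "length (fst (kronecker A A')) = length (fst (kronecker B B'))"
    "i < length (fst (kronecker B B'))"
    using len len' assms(3) by (simp_all add: fst_kronecker)
  moreover have "fst (kronecker A A') ! j = fst (kronecker B B') ! j"
    if "j < length (fst (kronecker B B'))" "j \<noteq> i" for j
    using that eqK assms(3) by (simp add: fst_kronecker)
  ultimately show ?thesis by (intro mode_restrictsI[where M = N])
qed

lemma mode_restricts_refl:
  assumes "i < length (fst A)"
  shows "mode_restricts i A A"
proof -
  have "snd A I = (\<Sum>b<fst A ! i. (if b = I ! i then 1 else 0) * snd A (I[i := b]))"
    if "I \<in> multi_indices (fst A)" for I
  proof -
    have "(\<Sum>b<fst A ! i. (if b = I ! i then 1 else 0) * snd A (I[i := b]))
        = (\<Sum>b<fst A ! i. if b = I ! i then snd A I else 0)"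
      by (intro sum.cong) auto
    also have "\<dots> = snd A I" using that assms by (simp add: multi_indices_def)
    finally show ?thesis by simp
  qed
  then show ?thesis
    using assms by (intro mode_restrictsI[where M = "\<lambda>x b. if b = x then 1 else 0"]) auto
qed

lemma mode_restricts_kronecker_power:
  assumes "mode_restricts i A B"
  shows "mode_restricts i (kronecker_power A m) (kronecker_power B m)"
proof (induction m)
  case 0
  have "length (fst A) = length (fst B)" "i < length (fst B)"
    using assms by (auto simp: mode_restricts_def)
  then show ?case by (auto intro!: mode_restricts_refl simp: pure_tensor_def)
next
  case (Suc m)
  then show ?case
    using assms by (simp add: mode_restricts_kronecker length_kronecker_power)
qed

text \<open>Restrictions pass to powers, and restrictions both ways make the same lengths
  \<open>r\<close> possible, so the minima agree.\<close>

lemma mode_equivalent_tensor_rank_power: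
  assumes "mode_restricts i A B" "mode_restricts i B A"
  shows "tensor_rank (kronecker_power A m) = tensor_rank (kronecker_power B m)"
proof -
  have "(\<exists>u. rank_decomp (kronecker_power A m) r u) \<longleftrightarrow> (\<exists>u. rank_decomp (kronecker_power B m) r u)"
    for r
    using assms[THEN mode_restricts_kronecker_power, of m] mode_restricts_rank_decomp by blast
  then show ?thesis by (simp add: tensor_rank_eq extensional_kronecker_power)
qed

subsection \<open>Independent slices\<close>

text \<open>The entry \<open>I ! i\<close> is overwritten, so \<open>I\<close> only addresses a
  position inside the slices. If the format is 0 in another direction, there are no positions, and
  independence forces \<open>fst T ! i = 0\<close>.\<close>

definition indep_slices :: "nat \<Rightarrow> 'a::field tensor \<Rightarrow> bool" where
  "indep_slices i T \<longleftrightarrow> (\<forall>c.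
    (\<forall>I\<in>multi_indices (fst T). (\<Sum>a<fst T ! i. c a * snd T (I[i := a])) = 0)
      \<longrightarrow> (\<forall>a<fst T ! i. c a = 0))"

text \<open>A relation between slices of the product, read at a fixed position \<open>K\<close> of
  \<open>B\<close>, is a relation between the slices of \<open>A\<close>, so its coefficients
  vanish. For fixed \<open>a\<close> and varying \<open>K\<close> these coefficients form a relation
  between the slices of \<open>B\<close>, which gives \<open>c = 0\<close>.\<close>

lemma indep_slices_kronecker:
  assumes A: "indep_slices i A" and B: "indep_slices i B"
    and len: "length (fst A) = length (fst B)" "i < length (fst B)"
  shows "indep_slices i (kronecker A B)"
  unfolding indep_slices_def
proof (intro allI impI)
  let ?k = "length (fst B)" and ?n = "fst A ! i" and ?m = "fst B ! i"
  fix c x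
  assume c: "\<forall>I\<in>multi_indices (fst (kronecker A B)).
      (\<Sum>a<fst (kronecker A B) ! i. c a * snd (kronecker A B) (I[i := a])) = 0"
    and x: "x < fst (kronecker A B) ! i"
  have nth: "fst (kronecker A B) ! i = ?n * ?m" using len by (simp add: fst_kronecker)
  have rel: "(\<Sum>a<?n. (\<Sum>b<?m. c (a * ?m + b) * snd B (K[i := b])) * snd A (J[i := a])) = 0"
    if J: "J \<in> multi_indices (fst A)" and K: "K \<in> multi_indices (fst B)" for J K
  proof -
    \<comment> \<open>The index of the product whose quotient and remainder parts are
      \<open>J\<close> and \<open>K\<close>.\<close>
    define I where "I = map (\<lambda>j. J ! j * fst B ! j + K ! j) [0..<?k]"
    have lI: "length I = ?k" by (simp add: I_def)
    have I: "I \<in> multi_indices (fst (kronecker A B))"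
      using J K len by (auto simp: multi_indices_def I_def fst_kronecker intro: mult_add_less)
    have dm: "map2 (div) I (fst B) = J" "map2 (mod) I (fst B) = K"
      using J K len by (auto intro!: nth_equalityI simp: I_def multi_indices_def)
    have "c (a * ?m + b) * snd (kronecker A B) (I[i := a * ?m + b])
        = c (a * ?m + b) * snd B (K[i := b]) * snd A (J[i := a])"
      if ab: "a < ?n" "b < ?m" for a b
    proof -
      have "I[i := a * ?m + b] \<in> multi_indices (fst (kronecker A B))"
        using mult_add_less[OF ab] nth by (intro multi_indices_update[OF I]) auto
      moreover have "map2 (div) (I[i := a * ?m + b]) (fst B) = J[i := a]"
        "map2 (mod) (I[i := a * ?m + b]) (fst B) = K[i := b]"
        using map2_div_mod_update[of I "fst B" "fst B" i b a] lI len ab by (simp_all add: dm)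
      ultimately show ?thesis by (simp add: snd_kronecker mult_ac)
    qed
    then have "(\<Sum>a<?n. (\<Sum>b<?m. c (a * ?m + b) * snd B (K[i := b])) * snd A (J[i := a]))
        = (\<Sum>a<?n. \<Sum>b<?m. c (a * ?m + b) * snd (kronecker A B) (I[i := a * ?m + b]))"
      unfolding sum_distrib_right by (intro sum.cong refl) (metis lessThan_iff)
    also have "\<dots> = (\<Sum>x<?n * ?m. c x * snd (kronecker A B) (I[i := x]))"
      by (rule sum_lessThan_mult[symmetric])
    finally show ?thesis using c I nth by simp
  qed
  have "(\<Sum>b<?m. c (a * ?m + b) * snd B (K[i := b])) = 0"
    if "K \<in> multi_indices (fst B)" "a < ?n" for K a
    using A[unfolded indep_slices_def, rule_format, of "\<lambda>a. \<Sum>b<?m. c (a * ?m + b) * snd B (K[i := b])"]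
      rel that by blast
  then have *: "c (a * ?m + b) = 0" if "a < ?n" "b < ?m" for a b
    using B[unfolded indep_slices_def, rule_format, of "\<lambda>b. c (a * ?m + b)"] that by blast
  have "x div ?m < ?n" "x mod ?m < ?m"
    using x nth
    by (metis less_mult_imp_div_less) (metis x nth mod_less_divisor mult_0_right not_less_zero neq0_conv)
  from *[OF this] show "c x = 0" by (simp only: div_mult_mod_eq)
qed

lemma indep_slices_kronecker_power:
  assumes "indep_slices i T" "i < length (fst T)"
  shows "indep_slices i (kronecker_power T m)"
proof (induction m)
  case 0
  let ?k = "length (fst T)"
  \<comment> \<open>The power 0 has a single coefficient, equal to 1, so its only slice in direction
    \<open>i\<close> is nonzero.\<close>
  have "replicate ?k 0 \<in> multi_indices (replicate ?k 1)" by (simp add: multi_indices_def)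
  moreover have "(replicate ?k 0)[i := 0] = replicate ?k (0::nat)"
    using assms(2) by (metis list_update_id nth_replicate)
  moreover have "multi_indices (replicate ?k (Suc 0)) = {replicate ?k 0}"
    by (auto simp: multi_indices_def intro: nth_equalityI)
  ultimately show ?case
    using assms(2) by (simp add: indep_slices_def pure_tensor_def)
next
  case (Suc m)
  then show ?case using assms by (simp add: indep_slices_kronecker length_kronecker_power)
qed

text \<open>With \<open>r\<close> terms, all slices in direction \<open>i\<close> lie in the span of
  the \<open>r\<close> tensors \<open>?P s\<close>, so more than \<open>r\<close> of them are
  dependent.\<close>

lemma indep_slices_rank_decomp_ge:
  assumes "indep_slices i T" "i < length (fst T)" "rank_decomp T r u"
  shows "fst T ! i \<le> r"
proof (rule ccontr)
  let ?n = "fst T ! i" and ?k = "length (fst T)"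
  assume "\<not> ?n \<le> r"
  \<comment> \<open>\<open>c\<close> is chosen orthogonal to the \<open>i\<close>-th vectors of all
    \<open>r\<close> terms: \<open>r\<close> equations in more than \<open>r\<close>
    unknowns.\<close>
  then obtain c where c: "\<exists>a<?n. c a \<noteq> 0" "\<And>s. s < r \<Longrightarrow> (\<Sum>a<?n. c a * u s i a) = 0"
    using homogeneous_system_nontrivial_solution[of "{..<?n}" r "\<lambda>s. u s i"] by auto
  have "(\<Sum>a<?n. c a * snd T (I[i := a])) = 0" if I: "I \<in> multi_indices (fst T)" for I
  proof -
    let ?P = "\<lambda>s. \<Prod>j\<in>{..<?k} - {i}. u s j (I ! j)"
    have lI: "length I = ?k" using I by (simp add: multi_indices_def)
    have "snd T (I[i := a]) = (\<Sum>s<r. u s i a * ?P s)" if "a < ?n" for a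
    proof -
      have "I[i := a] \<in> multi_indices (fst T)" using that by (intro multi_indices_update[OF I]) auto
      then have "snd T (I[i := a]) = (\<Sum>s<r. \<Prod>j<?k. u s j (I[i := a] ! j))"
        using assms(3) unfolding rank_decomp_def by blast
      then show ?thesis by (simp only: prod_nth_list_update[OF assms(2) lI])
    qed
    then have "(\<Sum>a<?n. c a * snd T (I[i := a])) = (\<Sum>a<?n. \<Sum>s<r. c a * u s i a * ?P s)"
      by (simp add: sum_distrib_left mult.assoc)
    also have "\<dots> = (\<Sum>s<r. (\<Sum>a<?n. c a * u s i a) * ?P s)"
      by (subst sum.swap) (simp add: sum_distrib_right)
    finally show ?thesis using c(2) by simp
  qed
  then show False using assms(1) c(1) unfolding indep_slices_def by blast
qed

lemma indep_slices_tensor_rank_power_ge: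
  assumes "indep_slices i T" "i < length (fst T)"
  shows "(fst T ! i) ^ m \<le> tensor_rank (kronecker_power T m)"
proof -
  let ?P = "kronecker_power T m"
  have len: "length (fst ?P) = length (fst T)" by (rule length_kronecker_power)
  then have "fst ?P \<noteq> []" using assms(2) by auto
  \<comment> \<open>\<open>LEAST\<close> is attained only if some decomposition exists, which the
    positive order guarantees.\<close>
  then obtain r where "\<exists>u. rank_decomp ?P r u" using rank_decomp_exists by blast
  then have "\<exists>u. rank_decomp ?P (tensor_rank ?P) u"
    unfolding tensor_rank_eq[OF extensional_kronecker_power] by (rule LeastI)
  then show ?thesis
    using indep_slices_rank_decomp_ge[of i ?P] indep_slices_kronecker_power[OF assms]
      nth_fst_kronecker_power[OF assms(2)] len assms(2) by metis
qed

subsection \<open>Deleting dependent slices\<close>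

text \<open>The entries are copied from \<open>T\<close>, so coefficients stay in \<open>S\<close>,
  which a general change of basis would not ensure. The index map enumerates the numbers other than
  \<open>p\<close> in increasing order.\<close>

definition delete_slice :: "nat \<Rightarrow> nat \<Rightarrow> 'a tensor \<Rightarrow> 'a tensor" where
  "delete_slice i p T =
    (let ns = (fst T)[i := fst T ! i - 1]
     in (ns, \<lambda>I\<in>multi_indices ns. snd T (I[i := if I ! i < p then I ! i else Suc (I ! i)])))"

lemma fst_delete_slice: "fst (delete_slice i p T) = (fst T)[i := fst T ! i - 1]"
  by (simp add: delete_slice_def Let_def)

lemma delete_slice_index:
  assumes "i < length (fst T)" "p < fst T ! i" "I \<in> multi_indices (fst (delete_slice i p T))"
  shows "I[i := if I ! i < p then I ! i else Suc (I ! i)] \<in> multi_indices (fst T)"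
proof (rule multi_indices_update[OF assms(3)])
  have "I ! i < fst T ! i - 1"
    using assms(1,3) by (auto simp: multi_indices_def fst_delete_slice dest!: spec[of _ i])
  then show "(if I ! i < p then I ! i else Suc (I ! i)) < fst T ! i"
    by (cases "I ! i < p") auto
qed (auto simp: fst_delete_slice)

lemma snd_delete_slice:
  "I \<in> multi_indices (fst (delete_slice i p T)) \<Longrightarrow>
    snd (delete_slice i p T) I = snd T (I[i := if I ! i < p then I ! i else Suc (I ! i)])"
  by (simp add: delete_slice_def Let_def)

lemma delete_slice_tensors_over:
  assumes "T \<in> tensors_over k S" "i < k" "p < fst T ! i"
  shows "delete_slice i p T \<in> tensors_over k S"
proof -
  let ?D = "delete_slice i p T"
  have T: "length (fst T) = k" "snd T \<in> multi_indices (fst T) \<rightarrow> S"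
    using assms(1) by (auto simp: tensors_over_def PiE_def)
  have "snd ?D I \<in> S" if "I \<in> multi_indices (fst ?D)" for I
    using delete_slice_index[OF _ assms(3) that] T assms(2) by (auto simp: snd_delete_slice that)
  moreover have "snd ?D \<in> extensional (multi_indices (fst ?D))"
    by (simp add: delete_slice_def Let_def)
  moreover have "length (fst ?D) = k" using T by (simp add: fst_delete_slice)
  ultimately show ?thesis by (auto simp: tensors_over_def PiE_def case_prod_beta)
qed

lemma delete_slice_restricts:
  assumes "i < length (fst T)" "p < fst T ! i"
  shows "mode_restricts i (delete_slice i p T) T"
proof -
  let ?q = "\<lambda>x. if x < p then x else Suc x"
  have "snd (delete_slice i p T) I
      = (\<Sum>b<fst T ! i. (if b = ?q (I ! i) then 1 else 0) * snd T (I[i := b]))"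
    if I: "I \<in> multi_indices (fst (delete_slice i p T))" for I
  proof -
    have "I[i := ?q (I ! i)] ! i < fst T ! i"
      using delete_slice_index[OF assms I] assms(1) by (simp only: multi_indices_def mem_Collect_eq)
    moreover have "length I = length (fst T)"
      using I by (simp add: multi_indices_def fst_delete_slice)
    ultimately have q: "?q (I ! i) < fst T ! i" using assms(1) by simp
    have "(\<Sum>b<fst T ! i. (if b = ?q (I ! i) then 1 else 0) * snd T (I[i := b]))
        = (\<Sum>b<fst T ! i. if b = ?q (I ! i) then snd T (I[i := ?q (I ! i)]) else 0)"
      by (intro sum.cong) auto
    also have "\<dots> = snd T (I[i := ?q (I ! i)])" using q by (subst sum.delta) auto
    finally show ?thesis using I by (simp add: snd_delete_slice)
  qed
  then show ?thesis
    by (rule mode_restrictsI[where M = "\<lambda>x b. if b = ?q x then 1 else 0", rotated 3])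
      (use assms in \<open>auto simp: fst_delete_slice\<close>)
qed

lemma sum_lessThan_remove:
  fixes g :: "nat \<Rightarrow> 'b::comm_monoid_add"
  assumes "p < n"
  shows "(\<Sum>a\<in>{..<n} - {p}. g a) = (\<Sum>b<n - 1. g (if b < p then b else Suc b))"
proof (rule sum.reindex_bij_witness[of _ "\<lambda>b. if b < p then b else Suc b"
      "\<lambda>a. if a < p then a else a - 1"])
qed (use assms in \<open>auto split: if_splits\<close>)

text \<open>Since \<open>c p\<close> is nonzero, the relation can be solved for slice
  \<open>p\<close>, which is thereby recovered from the remaining ones.\<close>

lemma restricts_delete_slice:
  assumes i: "i < length (fst T)" and p: "p < fst T ! i" and cp: "c p \<noteq> 0"
    and c: "\<And>I. I \<in> multi_indices (fst T) \<Longrightarrow> (\<Sum>a<fst T ! i. c a * snd T (I[i := a])) = 0"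
  shows "mode_restricts i T (delete_slice i p T)"
proof -
  let ?n = "fst T ! i" and ?D = "delete_slice i p T" and ?q = "\<lambda>x. if x < p then x else Suc x"
  \<comment> \<open>Row \<open>p\<close> holds the coefficients of slice \<open>p\<close> in terms
    of the others; the other rows copy one slice each.\<close>
  define M where "M x b = (if x = p then - c (?q b) / c p else if ?q b = x then 1 else 0)" for x b
  have nD: "fst ?D ! i = ?n - 1" using i by (simp add: fst_delete_slice)
  have "snd T I = (\<Sum>b<fst ?D ! i. M (I ! i) b * snd ?D (I[i := b]))"
    if I: "I \<in> multi_indices (fst T)" for I
  proof -
    have lI: "length I = length (fst T)" "I ! i < ?n" using I i by (auto simp: multi_indices_def)
    have D: "snd ?D (I[i := b]) = snd T (I[i := ?q b])" if "b < ?n - 1" for b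
    proof -
      have "I[i := b] \<in> multi_indices (fst ?D)"
        using that i by (intro multi_indices_update[OF I]) (auto simp: fst_delete_slice)
      then show ?thesis using lI i by (simp add: snd_delete_slice)
    qed
    \<comment> \<open>The row of \<open>M\<close> at \<open>I ! i\<close>, written in the original
      numbering of the slices.\<close>
    define m where "m a = (if I ! i = p then - c a / c p else if a = I ! i then 1 else 0)" for a
    have "(\<Sum>b<fst ?D ! i. M (I ! i) b * snd ?D (I[i := b]))
        = (\<Sum>b<?n - 1. m (?q b) * snd T (I[i := ?q b]))"
      unfolding nD using D by (intro sum.cong refl) (simp add: M_def m_def)
    also have "\<dots> = (\<Sum>a\<in>{..<?n} - {p}. m a * snd T (I[i := a]))"
      by (rule sum_lessThan_remove[OF p, symmetric])
    also have "\<dots> = snd T I"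
    proof (cases "I ! i = p")
      case True
      have "0 = c p * snd T (I[i := p]) + (\<Sum>a\<in>{..<?n} - {p}. c a * snd T (I[i := a]))"
        using c[OF I] p by (simp add: sum.remove[of "{..<?n}" p])
      moreover have "I[i := p] = I" using True by auto
      ultimately have "snd T I = - (\<Sum>a\<in>{..<?n} - {p}. c a * snd T (I[i := a])) / c p"
        using cp by (simp add: field_simps eq_neg_iff_add_eq_0)
      also have "\<dots> = (\<Sum>a\<in>{..<?n} - {p}. m a * snd T (I[i := a]))"
        using True by (simp add: m_def sum_divide_distrib sum_negf)
      finally show ?thesis by simp
    next
      case False
      have "(\<Sum>a\<in>{..<?n} - {p}. m a * snd T (I[i := a]))
          = (\<Sum>a\<in>{..<?n} - {p}. if a = I ! i then snd T I else 0)"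
        using False by (intro sum.cong) (auto simp: m_def)
      then show ?thesis using False lI by simp
    qed
    finally show ?thesis by simp
  qed
  then show ?thesis
    by (rule mode_restrictsI[rotated 3]) (use i in \<open>auto simp: fst_delete_slice\<close>)
qed

text \<open>Dependent slices are deleted one at a time; the sum of the format strictly decreases, so
  the process ends.\<close>

lemma ex_concise_tensor:
  assumes "T \<in> tensors_over k S"
  shows "\<exists>T'\<in>tensors_over k S. (\<forall>i<k. indep_slices i T') \<and>
    (\<forall>m. tensor_rank (kronecker_power T' m) = tensor_rank (kronecker_power T m))"
  using assms
proof (induction "sum_list (fst T)" arbitrary: T rule: less_induct)
  case less
  have len: "length (fst T) = k" using less.prems by (auto simp: tensors_over_def)
  show ?case
  proof (cases "\<forall>i<k. indep_slices i T")
    case True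
    then show ?thesis using less.prems by blast
  next
    case False
    then obtain i where i: "i < k" "\<not> indep_slices i T" by blast
    then obtain c p where cp:
      "\<And>I. I \<in> multi_indices (fst T) \<Longrightarrow> (\<Sum>a<fst T ! i. c a * snd T (I[i := a])) = 0"
      "p < fst T ! i" "c p \<noteq> 0"
      unfolding indep_slices_def by blast
    let ?D = "delete_slice i p T"
    \<comment> \<open>Keeps the natural-number subtraction in \<open>sum_list_update\<close> from
      truncating.\<close>
    have "fst T ! i \<le> sum_list (fst T)" using i len by (simp add: elem_le_sum_list)
    then have "sum_list (fst ?D) < sum_list (fst T)"
      using i len cp(2) by (simp add: fst_delete_slice sum_list_update)
    moreover have "?D \<in> tensors_over k S"
      using delete_slice_tensors_over less.prems i(1) cp(2) .
    moreover have "tensor_rank (kronecker_power ?D m) = tensor_rank (kronecker_power T m)" for m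
      using i len cp
      by (intro mode_equivalent_tensor_rank_power[of i] delete_slice_restricts
          restricts_delete_slice[of i T p c]) auto
    ultimately show ?thesis using less.hyps[of ?D] by auto
  qed
qed

subsection \<open>Discreteness\<close>

lemma finite_tensors_over_bounded:
  assumes "finite S"
  shows "finite {T \<in> tensors_over k S. \<forall>i<k. fst T ! i \<le> N}"
proof (rule finite_subset)
  let ?L = "{ns. set ns \<subseteq> {..N} \<and> length ns = k}"
  show "{T \<in> tensors_over k S. \<forall>i<k. fst T ! i \<le> N}
      \<subseteq> Sigma ?L (\<lambda>ns. multi_indices ns \<rightarrow>\<^sub>E S)"
    by (auto simp: tensors_over_def in_set_conv_nth)
  show "finite (Sigma ?L (\<lambda>ns. multi_indices ns \<rightarrow>\<^sub>E S))"
    using assms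
    by (intro finite_SigmaI finite_lists_length_eq finite_PiE finite_multi_indices) auto
qed

lemma concise_format_le_asymptotic_rank:
  assumes "indep_slices i T" "i < length (fst T)"
    and "convergent (\<lambda>m. root m (real (tensor_rank (kronecker_power T m))))"
  shows "real (fst T ! i) \<le> asymptotic_rank T"
proof -
  have "(\<lambda>m. root m (real (tensor_rank (kronecker_power T m)))) \<longlonglongrightarrow> asymptotic_rank T"
    using assms(3) unfolding asymptotic_rank_def by (simp add: convergent_LIMSEQ_iff)
  \<comment> \<open>The bound starts at 1 because \<open>root 0\<close> is constantly 0.\<close>
  moreover have "real (fst T ! i) \<le> root m (real (tensor_rank (kronecker_power T m)))"
    if "1 \<le> m" for m
  proof -
    have "real (fst T ! i) ^ m \<le> real (tensor_rank (kronecker_power T m))"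
      using indep_slices_tensor_rank_power_ge[OF assms(1,2), of m]
      by (metis of_nat_le_iff of_nat_power)
    then have "root m (real (fst T ! i) ^ m) \<le> root m (real (tensor_rank (kronecker_power T m)))"
      using that by simp
    then show ?thesis using that by (simp add: real_root_power_cancel)
  qed
  ultimately show ?thesis by (intro LIMSEQ_le_const) auto
qed

text \<open>
  On a divergent sequence \<^const>\<open>lim\<close> is one fixed junk value, which would add only one point
  to the range; so Fekete's lemma can be avoided.
\<close>

lemma finite_asymptotic_ranks_below:
  fixes S :: "'a::field set"
  assumes "finite S"
  shows "finite {y \<in> asymptotic_rank ` tensors_over k S. y \<le> C}"
proof (rule finite_subset)
  let ?N = "nat \<lfloor>C\<rfloor>"
  \<comment> \<open>For \<open>k = 0\<close> the format bound is vacuous; the set is still finite,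
    as the only format is the empty list.\<close>
  let ?B = "{T \<in> tensors_over k S. \<forall>i<k. fst T ! i \<le> ?N}"
  let ?junk = "THE L::real. False"
  show "{y \<in> asymptotic_rank ` tensors_over k S. y \<le> C} \<subseteq> insert ?junk (asymptotic_rank ` ?B)"
  proof
    fix y assume "y \<in> {y \<in> asymptotic_rank ` tensors_over k S. y \<le> C}"
    then obtain T where T: "T \<in> tensors_over k S" "y = asymptotic_rank T" "y \<le> C" by blast
    obtain T' where T': "T' \<in> tensors_over k S" "\<And>i. i < k \<Longrightarrow> indep_slices i T'"
      "\<And>m. tensor_rank (kronecker_power T' m) = tensor_rank (kronecker_power T m)"
      using ex_concise_tensor[OF T(1)] by blast
    have y: "y = asymptotic_rank T'" using T T'(3) by (simp add: asymptotic_rank_def)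
    show "y \<in> insert ?junk (asymptotic_rank ` ?B)"
    proof (cases "convergent (\<lambda>m. root m (real (tensor_rank (kronecker_power T' m))))")
      case True
      have "length (fst T') = k" using T'(1) by (auto simp: tensors_over_def)
      then have "real (fst T' ! i) \<le> C" if "i < k" for i
        using concise_format_le_asymptotic_rank[OF T'(2) _ True] that y T(3) by fastforce
      then have "T' \<in> ?B" using T'(1) by (auto simp: le_nat_floor)
      then show ?thesis using y by blast
    next
      case False
      then have "y = ?junk" by (simp add: y asymptotic_rank_def lim_def convergent_def)
      then show ?thesis by blast
    qed
  qed
  show "finite (insert ?junk (asymptotic_rank ` ?B))"
    using finite_tensors_over_bounded[OF assms] by blast
qed

text \<open>Every open set around an accumulation point contains infinitely many values. A half-line
  serves as the neighbourhood, since finiteness is known below any bound.\<close>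

lemma no_islimpt_asymptotic_rank:
  fixes S :: "'a::field set"
  assumes "finite S"
  shows "\<not> x islimpt (asymptotic_rank ` tensors_over k S)"
proof
  assume "x islimpt (asymptotic_rank ` tensors_over k S)"
  then have "infinite ({..<x + 1} \<inter> asymptotic_rank ` tensors_over k S)"
    unfolding islimpt_eq_acc_point by (auto dest!: spec[of _ "{..<x + 1}"])
  moreover have "finite ({..<x + 1} \<inter> asymptotic_rank ` tensors_over k S)"
    by (rule finite_subset[OF _ finite_asymptotic_ranks_below[OF assms, of k "x + 1"]]) auto
  ultimately show False by blast
qed

text \<open>Accumulation refers to the image set, so a value shared by infinitely many tensors
  counts once. The finite field case takes \<open>UNIV\<close> as the coefficient set.\<close>

theorem theorem4p4:
  fixes S :: "'a::field set" and k :: nat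
  assumes "finite S"
  shows "(\<forall>x::real. \<not> x islimpt (asymptotic_rank ` tensors_over k S)) \<and>
    (finite (UNIV :: 'a set) \<longrightarrow>
      (\<forall>x::real. \<not> x islimpt (asymptotic_rank ` tensors_over k (UNIV :: 'a set))))"
  using assms no_islimpt_asymptotic_rank by blast

end
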